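(* Let $G$ be a weakly weight-$f$-equitable graph with weight-quotient graphs $\{G^*_c\}_{c\in C}$, where $C$ is the color set of $f$. Then, for any vertices $u$ and $v$ in $G$, \[ H_m(G;(v,u))=H(G^*_{c_v};(c_v,v_u)), \] where $c_v=f(v,v)$ and $v_u=f(v,u)$.
   Context: The graph $G$ is finite, connected and undirected, with vertex set $V$ and adjacency matrix $A$; $G(u)$ is the set of neighbours of $u$. For a nonnegative square matrix $M=(m_{ij})$, $T(M)$ is the matrix with $(i,j)$-entry $m_{ij}/\sum_l m_{lj}$, read as the transition probability from $j$ to $i$. Let $\lambda_1$ be the largest eigenvalue of $A$ and $\nu=(\nu_u)_{u\in V}$ its positive unit eigenvector (Perron eigenvector), $D_\nu=\mathrm{diag}(\nu)$. The maximal entropy random walk on $G$ has transition matrix $T(D_\nu A)$, i.e. it moves from $u$ to $v\in G(u)$ with probability $\nu_v/\sum_{x\in G(u)}\nu_x$. $H_m(G;(v,u))$ is the expected number of steps needed by this walk started at $u$ to reach $v$ for the first time, with $H_m(G;(v,v))=0$. For a partition $P=\{V_0,\ldots,V_m\}$ of $V$ (empty blocks are allowed) and $u\in V_j$, put $b^*_{ij}(u)=\frac{1}{\nu_u}\sum_{v\in G(u)\cap V_i}\nu_v$. $P$ is weight-equitable if, for all $i,j$, $b^*_{ij}(u)$ takes the same value $b^*_{ij}$ for all $u\in V_j$. The weight-regular quotient matrix is $B^*=(b^*_{ij})$ (indexed by the nonempty blocks), and the weight-quotient graph is the weighted directed graph (loops allowed) whose vertices are the nonempty blocks and whose adjacency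 matrix is $B^*$. Weakly weight-$f$-equitable graphs: let $f:V\times V\to\{c_1,\ldots,c_s,x_1,\ldots,x_r\}$ be a function (the listed values being distinct) with $f(v,u)\in\{c_1,\ldots,c_s\}$ if $u=v$ and $f(v,u)\in\{x_1,\ldots,x_r\}$ if $u\ne v$. The set $\{c_1,\ldots,c_s\}$ is the color set of $f$ and $\{x_1,\ldots,x_r\}$ its relation set. For $o\in V$ and a value $x$ let $F_x(o)=\{u\in V: f(o,u)=x\}$ and $P_o=\{F_{f(o,o)}(o),F_{x_1}(o),\ldots,F_{x_r}(o)\}$. $G$ is weakly weight-$f$-equitable if for all $o\in V$: (i) $F_{f(o,o)}(o)=\{o\}$; (ii) $P_o$ is weight-equitable; (iii) the weight-quotient graph of $P_o$ depends only on the value $f(o,o)$. In (iii) the block $F_x(o)$ is identified with its label $x$: if $f(o,o)=f(o',o')$, then $P_o$ and $P_{o'}$ have the same labels of nonempty blocks and the same weight-regular quotient matrix indexed by these labels. For a color $c$, $G^*_c$ denotes the weight-quotient graph of $P_o$ for vertices $o$ with $f(o,o)=c$, with vertices identified with labels, and $B^*(c)$ its adjacency matrix. The simple random walk on $G^*_c$ is the Markov chain with transition matrix $T(B^*(c))$; $H(G^*_c;(x,y))$ is the expected number of steps to first reach $x$ starting from $y$, with value $0$ when $x=y$. *)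

theory Defs
  imports "HOL-Probability.Probability" "Graph_Theory.Graph_Theory"
begin

text \<open>
  Matrices are functions of a row and a column index, always used together with an explicit finite
  index set. Following the column convention, entry \<open>i j\<close> of a transition matrix is the
  probability of moving from \<open>j\<close> to \<open>i\<close>, and hitting times take the target before the start.
\<close>

section \<open>Eigenvalues and the Perron eigenvector\<close>

definition adjacency_matrix :: "'a pair_pre_digraph \<Rightarrow> 'a \<Rightarrow> 'a \<Rightarrow> real" where
  "adjacency_matrix G u v = (if (u, v) \<in> parcs G then 1 else 0)"

definition neighbours :: "'a pair_pre_digraph \<Rightarrow> 'a \<Rightarrow> 'a set" where
  "neighbours G u = {v \<in> pverts G. (u, v) \<in> parcs G}"

definition is_eigenvector :: "'i set \<Rightarrow> ('i \<Rightarrow> 'i \<Rightarrow> real) \<Rightarrow> real \<Rightarrow> ('i \<Rightarrow> real) \<Rightarrow> bool" where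
  "is_eigenvector I M \<mu> x \<longleftrightarrow>
     (\<exists>i\<in>I. x i \<noteq> 0) \<and> (\<forall>i\<in>I. (\<Sum>j\<in>I. M i j * x j) = \<mu> * x i)"

definition is_eigenvalue :: "'i set \<Rightarrow> ('i \<Rightarrow> 'i \<Rightarrow> real) \<Rightarrow> real \<Rightarrow> bool" where
  "is_eigenvalue I M \<mu> \<longleftrightarrow> (\<exists>x. is_eigenvector I M \<mu> x)"

text \<open>
  Only real eigenvalues are compared below; all eigenvalues of the symmetric matrix \<open>A\<close> are real.
\<close>

definition is_largest_eigenvalue :: "'i set \<Rightarrow> ('i \<Rightarrow> 'i \<Rightarrow> real) \<Rightarrow> real \<Rightarrow> bool" where
  "is_largest_eigenvalue I M \<mu> \<longleftrightarrow>
     is_eigenvalue I M \<mu> \<and> (\<forall>\<mu>'. is_eigenvalue I M \<mu>' \<longrightarrow> \<mu>' \<le> \<mu>)"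

definition is_perron_eigenvector :: "'a pair_pre_digraph \<Rightarrow> ('a \<Rightarrow> real) \<Rightarrow> bool" where
  "is_perron_eigenvector G \<nu> \<longleftrightarrow>
     (\<exists>\<rho>. is_largest_eigenvalue (pverts G) (adjacency_matrix G) \<rho> \<and>
           is_eigenvector (pverts G) (adjacency_matrix G) \<rho> \<nu>) \<and>
     (\<forall>u\<in>pverts G. 0 < \<nu> u) \<and> (\<Sum>u\<in>pverts G. (\<nu> u)\<^sup>2) = 1"


section \<open>Markov chains and expected hitting times\<close>

definition transition_matrix :: "'i set \<Rightarrow> ('i \<Rightarrow> 'i \<Rightarrow> real) \<Rightarrow> 'i \<Rightarrow> 'i \<Rightarrow> real" where
  "transition_matrix I M i j = M i j / (\<Sum>l\<in>I. M l j)"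

text \<open>
  The kernel producing the state at time \<open>n\<close> from the states at the earlier times, and the law on
  trajectories \<open>nat \<Rightarrow> 's\<close> of the chain started at \<open>y\<close>, obtained from the Ionescu-Tulcea theorem.
\<close>

definition chain_kernel ::
    "'s set \<Rightarrow> ('s \<Rightarrow> 's \<Rightarrow> real) \<Rightarrow> 's \<Rightarrow> nat \<Rightarrow> (nat \<Rightarrow> 's) \<Rightarrow> 's measure" where
  "chain_kernel S P y n \<omega> =
     (case n of 0 \<Rightarrow> return (count_space S) y
      | Suc m \<Rightarrow> point_measure S (\<lambda>i. ennreal (P i (\<omega> m))))"

definition chain_law :: "'s set \<Rightarrow> ('s \<Rightarrow> 's \<Rightarrow> real) \<Rightarrow> 's \<Rightarrow> (nat \<Rightarrow> 's) measure" where
  "chain_law S P y =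
     projective_family.lim UNIV
       (Ionescu_Tulcea.CI (chain_kernel S P y) (\<lambda>_. count_space S)) (\<lambda>_. count_space S)"

lemma Ionescu_Tulcea_chain_kernel:
  assumes S: "finite S" and y: "y \<in> S"
    and nonneg: "\<And>i j. i \<in> S \<Longrightarrow> j \<in> S \<Longrightarrow> 0 \<le> P i j"
    and stoch: "\<And>j. j \<in> S \<Longrightarrow> (\<Sum>i\<in>S. P i j) = 1"
  shows "Ionescu_Tulcea (chain_kernel S P y) (\<lambda>_. count_space S)"
proof (rule Ionescu_Tulcea.intro)
  have pm: "prob_space (point_measure S (\<lambda>i. ennreal (P i j)))" if "j \<in> S" for j
  proof (rule prob_spaceI)
    have "(\<Sum>i\<in>S. ennreal (P i j)) = ennreal (\<Sum>i\<in>S. P i j)"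
      using nonneg that by (intro sum_ennreal) auto
    then show "emeasure (point_measure S (\<lambda>i. ennreal (P i j)))
                 (space (point_measure S (\<lambda>i. ennreal (P i j)))) = 1"
      using S stoch[OF that] by (simp add: space_point_measure emeasure_point_measure_finite)
  qed
  fix n
  have meas: "(\<lambda>j. point_measure S (\<lambda>i. ennreal (P i j)))
      \<in> measurable (count_space S) (subprob_algebra (count_space S))"
    using pm by (auto simp: measurable_count_space_eq1 space_subprob_algebra sets_point_measure
        intro: prob_space_imp_subprob_space)
  show "chain_kernel S P y n
      \<in> measurable (PiM {0..<n} (\<lambda>_. count_space S)) (subprob_algebra (count_space S))"
  proof (cases n)
    case 0
    have "return (count_space S) y \<in> space (subprob_algebra (count_space S))"
      using y by (auto simp: space_subprob_algebra
          intro!: prob_space_imp_subprob_space prob_space_return)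
    then show ?thesis using 0 by (simp add: chain_kernel_def[abs_def])
  next
    case (Suc m)
    have "(\<lambda>\<omega>. \<omega> m) \<in> measurable (PiM {0..<n} (\<lambda>_. count_space S)) (count_space S)"
      using Suc by (intro measurable_component_singleton) auto
    from measurable_compose[OF this meas] show ?thesis
      using Suc by (simp add: chain_kernel_def[abs_def])
  qed
  show "prob_space (chain_kernel S P y n \<omega>)"
    if "\<omega> \<in> space (PiM {0..<n} (\<lambda>_. count_space S))" for \<omega>
  proof -
    from that have "\<omega> m \<in> S" if "m < n" for m
      using that by (auto simp: space_PiM PiE_iff)
    then show ?thesis
      using y pm by (auto simp: chain_kernel_def intro!: prob_space_return split: nat.split)
  qed
qed

definition hitting_time :: "'s \<Rightarrow> (nat \<Rightarrow> 's) \<Rightarrow> enat" where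
  "hitting_time x \<omega> = (INF n \<in> {n. \<omega> n = x}. enat n)"

text \<open>
  The case \<open>x = y\<close> is separated because the transition matrix may fail to be stochastic: the column
  of the only vertex of a one-vertex graph without a loop is zero.
\<close>

definition expected_hitting_time :: "'s set \<Rightarrow> ('s \<Rightarrow> 's \<Rightarrow> real) \<Rightarrow> 's \<Rightarrow> 's \<Rightarrow> ennreal" where
  "expected_hitting_time S P x y =
     (if x = y then 0
      else (\<integral>\<^sup>+ \<omega>. ennreal_of_enat (hitting_time x \<omega>) \<partial>chain_law S P y))"

text \<open>The matrix transformed here is the product of \<open>diag \<nu>\<close> and the adjacency matrix.\<close>

definition merw_matrix :: "'a pair_pre_digraph \<Rightarrow> ('a \<Rightarrow> real) \<Rightarrow> 'a \<Rightarrow> 'a \<Rightarrow> real" where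
  "merw_matrix G \<nu> = transition_matrix (pverts G) (\<lambda>i j. \<nu> i * adjacency_matrix G i j)"

definition merw_hitting_time :: "'a pair_pre_digraph \<Rightarrow> ('a \<Rightarrow> real) \<Rightarrow> 'a \<Rightarrow> 'a \<Rightarrow> ennreal" where
  "merw_hitting_time G \<nu> v u = expected_hitting_time (pverts G) (merw_matrix G \<nu>) v u"


section \<open>Weight-equitable partitions and weight-quotient graphs\<close>

definition weight_intersection ::
    "'a pair_pre_digraph \<Rightarrow> ('a \<Rightarrow> real) \<Rightarrow> 'a set \<Rightarrow> 'a \<Rightarrow> real" where
  "weight_intersection G \<nu> X u = (1 / \<nu> u) * (\<Sum>v \<in> neighbours G u \<inter> X. \<nu> v)"

text \<open>A partition is a family \<open>B\<close> of blocks indexed by a set \<open>L\<close> of labels; blocks may be empty.\<close>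

definition weight_equitable ::
    "'a pair_pre_digraph \<Rightarrow> ('a \<Rightarrow> real) \<Rightarrow> 'l set \<Rightarrow> ('l \<Rightarrow> 'a set) \<Rightarrow> bool" where
  "weight_equitable G \<nu> L B \<longleftrightarrow>
     (\<Union>i\<in>L. B i) = pverts G \<and> disjoint_family_on B L \<and>
     (\<forall>i\<in>L. \<forall>j\<in>L. \<forall>u\<in>B j. \<forall>u'\<in>B j.
        weight_intersection G \<nu> (B i) u = weight_intersection G \<nu> (B i) u')"

record 'l weighted_digraph =
  wverts :: "'l set"
  weight :: "'l \<Rightarrow> 'l \<Rightarrow> real"

text \<open>
  The adjacency matrix is set to zero outside the vertex set, so that equality of records means
  equality of the vertex sets and of the matrices indexed by them.
\<close>

definition weight_quotient_graph ::
    "'a pair_pre_digraph \<Rightarrow> ('a \<Rightarrow> real) \<Rightarrow> 'l set \<Rightarrow> ('l \<Rightarrow> 'a set) \<Rightarrow> 'l weighted_digraph" where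
  "weight_quotient_graph G \<nu> L B =
     \<lparr> wverts = {i \<in> L. B i \<noteq> {}},
       weight = (\<lambda>i j. if i \<in> L \<and> B i \<noteq> {} \<and> j \<in> L \<and> B j \<noteq> {}
                       then (THE b. \<forall>u\<in>B j. weight_intersection G \<nu> (B i) u = b)
                       else 0) \<rparr>"

definition srw_hitting_time :: "'l weighted_digraph \<Rightarrow> 'l \<Rightarrow> 'l \<Rightarrow> ennreal" where
  "srw_hitting_time Q x y =
     expected_hitting_time (wverts Q) (transition_matrix (wverts Q) (weight Q)) x y"


section \<open>Weakly weight-\<open>f\<close>-equitable graphs\<close>

text \<open>\<open>C\<close> is the color set and \<open>R\<close> the relation set of \<open>f\<close>.\<close>

definition color_relation_function ::
    "'a set \<Rightarrow> ('a \<Rightarrow> 'a \<Rightarrow> 'l) \<Rightarrow> 'l set \<Rightarrow> 'l set \<Rightarrow> bool" where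
  "color_relation_function V f C R \<longleftrightarrow>
     finite C \<and> finite R \<and> C \<inter> R = {} \<and>
     (\<forall>v\<in>V. \<forall>u\<in>V. if u = v then f v u \<in> C else f v u \<in> R)"

definition f_block :: "'a pair_pre_digraph \<Rightarrow> ('a \<Rightarrow> 'a \<Rightarrow> 'l) \<Rightarrow> 'a \<Rightarrow> 'l \<Rightarrow> 'a set" where
  "f_block G f z x = {u \<in> pverts G. f z u = x}"

definition f_labels :: "('a \<Rightarrow> 'a \<Rightarrow> 'l) \<Rightarrow> 'l set \<Rightarrow> 'a \<Rightarrow> 'l set" where
  "f_labels f R z = insert (f z z) R"

definition vertex_quotient_graph ::
    "'a pair_pre_digraph \<Rightarrow> ('a \<Rightarrow> real) \<Rightarrow> ('a \<Rightarrow> 'a \<Rightarrow> 'l) \<Rightarrow> 'l set \<Rightarrow> 'a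
       \<Rightarrow> 'l weighted_digraph" where
  "vertex_quotient_graph G \<nu> f R z =
     weight_quotient_graph G \<nu> (f_labels f R z) (f_block G f z)"

definition weakly_weight_f_equitable ::
    "'a pair_pre_digraph \<Rightarrow> ('a \<Rightarrow> real) \<Rightarrow> ('a \<Rightarrow> 'a \<Rightarrow> 'l) \<Rightarrow> 'l set \<Rightarrow> 'l set \<Rightarrow> bool" where
  "weakly_weight_f_equitable G \<nu> f C R \<longleftrightarrow>
     color_relation_function (pverts G) f C R \<and>
     (\<forall>z\<in>pverts G. f_block G f z (f z z) = {z}) \<and>
     (\<forall>z\<in>pverts G. weight_equitable G \<nu> (f_labels f R z) (f_block G f z)) \<and>
     (\<forall>z\<in>pverts G. \<forall>z'\<in>pverts G. f z z = f z' z' \<longrightarrow>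
        vertex_quotient_graph G \<nu> f R z = vertex_quotient_graph G \<nu> f R z')"

text \<open>
  The graph \<open>G\<^sup>*\<close> of a color \<open>c\<close>; well defined when \<open>G\<close> is weakly weight-\<open>f\<close>-equitable and \<open>c\<close> is
  the color of some vertex.
\<close>

definition color_quotient_graph ::
    "'a pair_pre_digraph \<Rightarrow> ('a \<Rightarrow> real) \<Rightarrow> ('a \<Rightarrow> 'a \<Rightarrow> 'l) \<Rightarrow> 'l set \<Rightarrow> 'l
       \<Rightarrow> 'l weighted_digraph" where
  "color_quotient_graph G \<nu> f R c =
     (THE Q. \<exists>z\<in>pverts G. f z z = c \<and> Q = vertex_quotient_graph G \<nu> f R z)"

end

theory Submission
  imports Defs
begin

text \<open>
  The quotient walk is the image of the maximal entropy random walk under the block map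
  \<open>g = f v\<close>. From \<open>j\<close> the walk enters a block \<open>X\<close> with probability
  \<open>(\<Sum>i \<in> G(j) \<inter> X. \<nu> i) / (\<Sum>i \<in> G(j). \<nu> i)\<close>. Dividing both sums by \<open>\<nu> j\<close> turns them into entries
  and a column sum of the weight-quotient matrix, which by weight-equitability depend on \<open>j\<close> only
  through its block; so the chain can be lumped, and the lumped chain is the simple random walk on
  the quotient graph (\<open>merw_matrix_lumps\<close>). Since \<open>{v}\<close> is itself a block, the walk is at \<open>v\<close> exactly
  when its image is at \<open>f v v\<close>, and both walks have the same hitting time.

  To compare two laws on trajectory spaces it suffices here to express the expected hitting time of
  \<open>x\<close> by the matrix alone. It is the sum over \<open>n\<close> of the probabilities of avoiding \<open>x\<close> up to time
  \<open>n\<close>, and by the Markov property the \<open>n\<close>-th one is obtained by applying \<open>n\<close> times the transition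
  operator killed at \<open>x\<close> to the indicator function of the complement of \<open>x\<close>
  (\<open>expected_hitting_time_eq_suminf\<close>). Composition with the block map intertwines the killed
  operators of the chain and of its lumped chain (\<open>killed_step_lumped\<close>), so the two series agree
  term by term.
\<close>

section \<open>Integrals over the law of a finite Markov chain\<close>

context Ionescu_Tulcea
begin

text \<open>
  The projective limit marginal of an initial segment is the iterated kernel \<open>C\<close>, whose recursive
  equation is what makes one-step conditioning available.
\<close>

lemma distr_lim_restrict:
  "distr PF.lim (PiM {0..<n} M) (\<lambda>\<omega>. restrict \<omega> {0..<n}) = C 0 n (\<lambda>_. undefined)"
proof -
  have "n \<le> up_to {0..<n}"
    using up_to[of "{0..<n}"] by (cases "n = 0") auto
  then show ?thesis
    using distr_C[of n "up_to {0..<n}" "\<lambda>_. undefined" 0]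
    by (simp add: distr_lim CI_def)
qed

text \<open>A measure with a distribution of total mass one has total mass one itself; here the empty
  initial segment already suffices.\<close>

lemma prob_space_lim: "prob_space PF.lim"
proof (rule prob_space_distrD)
  show "(\<lambda>\<omega>. restrict \<omega> {0..<0}) \<in> measurable PF.lim (PiM {0..<0} M)"
    by (auto intro!: measurable_restrict_subset simp: measurable_cong_sets[OF PF.sets_lim])
  show "prob_space (distr PF.lim (PiM {0..<0} M) (\<lambda>\<omega>. restrict \<omega> {0..<0}))"
    unfolding distr_lim_restrict by (rule prob_space_C) simp
qed

lemma nn_integral_lim_restrict:
  assumes "h \<in> borel_measurable (PiM {0..<n} M)"
  shows "(\<integral>\<^sup>+\<omega>. h (restrict \<omega> {0..<n}) \<partial>PF.lim) = (\<integral>\<^sup>+x. h x \<partial>C 0 n (\<lambda>_. undefined))"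
  unfolding distr_lim_restrict[symmetric] using assms
  by (subst nn_integral_distr)
     (auto intro!: measurable_restrict_subset simp: measurable_cong_sets[OF PF.sets_lim])

text \<open>One-step conditioning: the last coordinate of an initial segment is integrated out first,
  against the kernel that produces it from the past.\<close>

lemma nn_integral_lim_Suc:
  assumes h: "h \<in> borel_measurable (PiM {0..<Suc n} M)"
  shows "(\<integral>\<^sup>+\<omega>. h (restrict \<omega> {0..<Suc n}) \<partial>PF.lim)
       = (\<integral>\<^sup>+\<omega>. (\<integral>\<^sup>+s. h ((restrict \<omega> {0..<n})(n := s)) \<partial>P n (restrict \<omega> {0..<n})) \<partial>PF.lim)"
proof -
  let ?H = "\<lambda>x. \<integral>\<^sup>+y. h y \<partial>eP n x"
  have H: "?H \<in> borel_measurable (PiM {0..<n} M)"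
    using h by measurable
  have "(\<integral>\<^sup>+\<omega>. h (restrict \<omega> {0..<Suc n}) \<partial>PF.lim) = (\<integral>\<^sup>+x. h x \<partial>C 0 (Suc n) (\<lambda>_. undefined))"
    by (rule nn_integral_lim_restrict[OF h])
  also have "\<dots> = (\<integral>\<^sup>+x. ?H x \<partial>C 0 n (\<lambda>_. undefined))"
    using h measurable_C[of 0 n]
    by (simp add: nn_integral_bind[where B="PiM {0..<Suc n} M"]
       measurable_cong_sets[OF sets_C refl])
  also have "\<dots> = (\<integral>\<^sup>+\<omega>. ?H (restrict \<omega> {0..<n}) \<partial>PF.lim)"
    by (rule nn_integral_lim_restrict[OF H, symmetric])
  also have "\<dots> = (\<integral>\<^sup>+\<omega>. (\<integral>\<^sup>+s. h ((restrict \<omega> {0..<n})(n := s)) \<partial>P n (restrict \<omega> {0..<n})) \<partial>PF.lim)"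
    using h by (intro nn_integral_cong nn_integral_eP) (auto simp: PF.space_lim space_PiM)
  finally show ?thesis .
qed

end

text \<open>
  One step of the chain as an operator on functions, with the chain stopped in \<open>x\<close> at payoff zero.
  A function \<open>\<phi>\<close> is mapped to its expected value after a step from \<open>j\<close>: the matrix acts on
  functions from the right because its columns are the probability vectors.
\<close>

definition killed_step :: "'s set \<Rightarrow> ('s \<Rightarrow> 's \<Rightarrow> real) \<Rightarrow> 's \<Rightarrow> ('s \<Rightarrow> ennreal) \<Rightarrow> 's \<Rightarrow> ennreal" where
  "killed_step S P x \<phi> j = (if j = x then 0 else \<Sum>i\<in>S. ennreal (P i j) * \<phi> i)"

lemma less_hitting_time_iff: "enat n < hitting_time x \<omega> \<longleftrightarrow> (\<forall>k\<le>n. \<omega> k \<noteq> x)"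
proof
  assume less: "enat n < hitting_time x \<omega>"
  show "\<forall>k\<le>n. \<omega> k \<noteq> x"
  proof (intro allI impI notI)
    fix k assume "k \<le> n" "\<omega> k = x"
    then have "hitting_time x \<omega> \<le> enat n"
      unfolding hitting_time_def by (intro INF_lower2[of k]) auto
    with less show False by simp
  qed
next
  assume avoid: "\<forall>k\<le>n. \<omega> k \<noteq> x"
  have "enat (Suc n) \<le> hitting_time x \<omega>"
    unfolding hitting_time_def
  proof (rule INF_greatest)
    fix k assume "k \<in> {k. \<omega> k = x}"
    with avoid have "\<not> k \<le> n" by auto
    then show "enat (Suc n) \<le> enat k" by simp
  qed
  then show "enat n < hitting_time x \<omega>"
    by (rule less_le_trans[rotated]) simp
qed

text \<open>An infimum over an index set independent of the trajectory, the form in which measurability of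
  hitting times follows from that of countable infima.\<close>

lemma hitting_time_eq_INF: "hitting_time x \<omega> = (INF n. if \<omega> n = x then enat n else \<infinity>)"
  unfolding hitting_time_def
proof (rule antisym)
  show "(INF n\<in>{n. \<omega> n = x}. enat n) \<le> (INF n. if \<omega> n = x then enat n else \<infinity>)"
    by (rule INF_greatest) (simp add: INF_lower)
  show "(INF n. if \<omega> n = x then enat n else \<infinity>) \<le> (INF n\<in>{n. \<omega> n = x}. enat n)"
  proof (rule INF_greatest)
    fix n assume "n \<in> {n. \<omega> n = x}"
    then show "(INF n. if \<omega> n = x then enat n else \<infinity>) \<le> enat n"
      by (intro INF_lower2[of n]) auto
  qed
qed

locale finite_chain =
  fixes S :: "'s set" and P :: "'s \<Rightarrow> 's \<Rightarrow> real"
  assumes finite_states: "finite S"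
    and nonneg: "\<And>i j. i \<in> S \<Longrightarrow> j \<in> S \<Longrightarrow> 0 \<le> P i j"
    and stochastic: "\<And>j. j \<in> S \<Longrightarrow> (\<Sum>i\<in>S. P i j) = 1"
begin

lemma sets_chain_law:
  assumes "y \<in> S"
  shows "sets (chain_law S P y) = sets (PiM UNIV (\<lambda>_. count_space S))"
proof -
  interpret Ionescu_Tulcea "chain_kernel S P y" "\<lambda>_. count_space S"
    using assms by (intro Ionescu_Tulcea_chain_kernel finite_states nonneg stochastic)
  show ?thesis by (simp add: chain_law_def PF.sets_lim)
qed

lemma measurable_killed:
  fixes \<psi> :: "'s \<Rightarrow> ennreal"
  shows "(\<lambda>\<omega>. if \<forall>k<n. \<omega> k \<noteq> x then \<psi> (\<omega> n) else 0)
    \<in> borel_measurable (PiM {0..<Suc n} (\<lambda>_. count_space S))"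
proof -
  have comp [measurable]: "(\<lambda>\<omega>. \<omega> k) \<in> measurable (PiM {0..<Suc n} (\<lambda>_. count_space S)) (count_space S)"
    if "k < Suc n" for k
    using that by (intro measurable_component_singleton) auto
  have "Measurable.pred (PiM {0..<Suc n} (\<lambda>_. count_space S)) (\<lambda>\<omega>. \<omega> k \<noteq> x)" if "k < n" for k
    using measurable_compose[OF comp[of k], of "\<lambda>s. s \<noteq> x" "count_space UNIV"] that by simp
  then have "Measurable.pred (PiM {0..<Suc n} (\<lambda>_. count_space S)) (\<lambda>\<omega>. \<forall>k\<in>{..<n}. \<omega> k \<noteq> x)"
    by (intro pred_intros_finite) auto
  then have [measurable]: "Measurable.pred (PiM {0..<Suc n} (\<lambda>_. count_space S)) (\<lambda>\<omega>. \<forall>k<n. \<omega> k \<noteq> x)"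
    by (simp add: Ball_def)
  have [measurable]: "(\<lambda>\<omega>. \<psi> (\<omega> n)) \<in> borel_measurable (PiM {0..<Suc n} (\<lambda>_. count_space S))"
    using measurable_compose[OF comp[of n], of \<psi> borel] by simp
  show ?thesis by measurable
qed

text \<open>
  The Markov property, in the only form needed. The payoff \<open>\<phi>\<close> is arbitrary because the induction
  shortens the trajectory at its end: conditioning on the first \<open>n\<close> steps replaces the payoff
  \<open>\<phi>\<close> at time \<open>n + 1\<close> by the payoff \<open>killed_step S P x \<phi>\<close> at time \<open>n\<close>, and the case \<open>j = x\<close> of the
  operator takes over the requirement of avoiding \<open>x\<close> at time \<open>n\<close>.
\<close>

lemma killed_integral:
  assumes y: "y \<in> S"
  shows "(\<integral>\<^sup>+\<omega>. (if \<forall>k<n. \<omega> k \<noteq> x then \<phi> (\<omega> n) else 0) \<partial>chain_law S P y)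
       = (killed_step S P x ^^ n) \<phi> y"
proof (induction n arbitrary: \<phi>)
  interpret Ionescu_Tulcea "chain_kernel S P y" "\<lambda>_. count_space S"
    using y by (intro Ionescu_Tulcea_chain_kernel finite_states nonneg stochastic)
  have law: "chain_law S P y = PF.lim" by (simp add: chain_law_def)
  case 0
  have "(\<integral>\<^sup>+\<omega>. \<phi> (\<omega> 0) \<partial>PF.lim) = (\<integral>\<^sup>+\<omega>. \<phi> y \<partial>PF.lim)"
    using nn_integral_lim_Suc[OF measurable_killed[of 0 x \<phi>]] y
    by (simp add: chain_kernel_def nn_integral_return)
  moreover note prob_space_lim
  ultimately show ?case by (simp add: law prob_space.emeasure_space_1 del: PF.space_lim)
next
  case (Suc n)
  interpret Ionescu_Tulcea "chain_kernel S P y" "\<lambda>_. count_space S"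
    using y by (intro Ionescu_Tulcea_chain_kernel finite_states nonneg stochastic)
  have law: "chain_law S P y = PF.lim" by (simp add: chain_law_def)
  have "(\<integral>\<^sup>+\<omega>. (if \<forall>k<Suc n. \<omega> k \<noteq> x then \<phi> (\<omega> (Suc n)) else 0) \<partial>PF.lim)
      = (\<integral>\<^sup>+\<omega>. (\<integral>\<^sup>+s. (if \<forall>k<Suc n. \<omega> k \<noteq> x then \<phi> s else 0)
           \<partial>point_measure S (\<lambda>i. ennreal (P i (\<omega> n)))) \<partial>PF.lim)"
    using nn_integral_lim_Suc[OF measurable_killed[of "Suc n" x \<phi>]]
    by (simp add: chain_kernel_def cong: if_cong)
  also have "\<dots> = (\<integral>\<^sup>+\<omega>. (if \<forall>k<n. \<omega> k \<noteq> x then killed_step S P x \<phi> (\<omega> n) else 0) \<partial>PF.lim)"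
  proof (rule nn_integral_cong)
    fix \<omega>
    have cond_sum: "(\<Sum>i\<in>S. ennreal (P i (\<omega> n)) * (if c then \<phi> i else 0))
        = (if c then \<Sum>i\<in>S. ennreal (P i (\<omega> n)) * \<phi> i else 0)" for c
      by simp
    have "(\<integral>\<^sup>+s. (if \<forall>k<Suc n. \<omega> k \<noteq> x then \<phi> s else 0) \<partial>point_measure S (\<lambda>i. ennreal (P i (\<omega> n))))
        = (if \<forall>k<Suc n. \<omega> k \<noteq> x then \<Sum>i\<in>S. ennreal (P i (\<omega> n)) * \<phi> i else 0)"
      unfolding nn_integral_point_measure_finite[OF finite_states] by (rule cond_sum)
    also have "\<dots> = (if \<forall>k<n. \<omega> k \<noteq> x then killed_step S P x \<phi> (\<omega> n) else 0)"
      by (auto simp: killed_step_def less_Suc_eq)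
    finally show "(\<integral>\<^sup>+s. (if \<forall>k<Suc n. \<omega> k \<noteq> x then \<phi> s else 0)
           \<partial>point_measure S (\<lambda>i. ennreal (P i (\<omega> n))))
        = (if \<forall>k<n. \<omega> k \<noteq> x then killed_step S P x \<phi> (\<omega> n) else 0)" .
  qed
  also have "\<dots> = (killed_step S P x ^^ n) (killed_step S P x \<phi>) y"
    using Suc.IH[of "killed_step S P x \<phi>"] by (simp add: law)
  finally show ?case
    by (simp add: law funpow_swap1)
qed

text \<open>The tail sum formula: the expectation of a time is the sum of the probabilities of exceeding
  \<open>n\<close>, and the hitting time of \<open>x\<close> exceeds \<open>n\<close> iff \<open>x\<close> is avoided before time \<open>n\<close> and at time \<open>n\<close>.\<close>

lemma expected_hitting_time_eq_suminf:
  assumes y: "y \<in> S" and "x \<noteq> y"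
  shows "expected_hitting_time S P x y
       = (\<Sum>n. (killed_step S P x ^^ n) (\<lambda>s. if s = x then 0 else 1) y)"
proof -
  let ?L = "chain_law S P y"
  have comp [measurable]: "(\<lambda>\<omega>. \<omega> k) \<in> measurable ?L (count_space S)" for k
    unfolding measurable_cong_sets[OF sets_chain_law[OF y] refl]
    by (intro measurable_component_singleton) auto
  have alive [measurable]: "Measurable.pred ?L (\<lambda>\<omega>. \<omega> k \<noteq> x)" for k
    using measurable_compose[OF comp[of k], of "\<lambda>s. s \<noteq> x" "count_space UNIV"] by simp
  have [measurable]: "hitting_time x \<in> measurable ?L (count_space UNIV)"
    unfolding hitting_time_eq_INF[abs_def] by measurable
  then have "expected_hitting_time S P x y
      = (\<Sum>n. emeasure ?L {\<omega> \<in> space ?L. enat n < hitting_time x \<omega>})"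
    using \<open>x \<noteq> y\<close> by (simp add: expected_hitting_time_def nn_integral_enat_function)
  also have "\<dots> = (\<Sum>n. (killed_step S P x ^^ n) (\<lambda>s. if s = x then 0 else 1) y)"
  proof (intro suminf_cong)
    fix n
    have "emeasure ?L {\<omega> \<in> space ?L. enat n < hitting_time x \<omega>}
        = (\<integral>\<^sup>+\<omega>. indicator {\<omega> \<in> space ?L. enat n < hitting_time x \<omega>} \<omega> \<partial>?L)"
      by (intro nn_integral_indicator[symmetric]) measurable
    also have "\<dots> = (\<integral>\<^sup>+\<omega>. (if \<forall>k<n. \<omega> k \<noteq> x then if \<omega> n = x then 0 else 1 else 0) \<partial>?L)"
      by (intro nn_integral_cong)
         (auto simp: less_hitting_time_iff le_less split: split_indicator)
    also have "\<dots> = (killed_step S P x ^^ n) (\<lambda>s. if s = x then 0 else 1) y"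
      by (rule killed_integral[OF y])
    finally show "emeasure ?L {\<omega> \<in> space ?L. enat n < hitting_time x \<omega>}
        = (killed_step S P x ^^ n) (\<lambda>s. if s = x then 0 else 1) y" .
  qed
  finally show ?thesis .
qed

end

section \<open>Lumping a chain along a block map\<close>

lemma sum_nonneg_blocks_ennreal:
  fixes p :: "'s \<Rightarrow> real"
  assumes "finite S" and "\<And>i. i \<in> S \<Longrightarrow> 0 \<le> p i"
  shows "(\<Sum>i\<in>S. ennreal (p i) * \<phi> (g i))
       = (\<Sum>a\<in>g ` S. ennreal (\<Sum>i\<in>{i \<in> S. g i = a}. p i) * \<phi> a)"
proof -
  have "(\<Sum>i\<in>S. ennreal (p i) * \<phi> (g i))
      = (\<Sum>a\<in>g ` S. \<Sum>i\<in>{i \<in> S. g i = a}. ennreal (p i) * \<phi> (g i))"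
    using assms(1) by (rule sum.image_gen)
  also have "\<dots> = (\<Sum>a\<in>g ` S. ennreal (\<Sum>i\<in>{i \<in> S. g i = a}. p i) * \<phi> a)"
  proof (intro sum.cong refl)
    fix a
    have "(\<Sum>i\<in>{i \<in> S. g i = a}. ennreal (p i) * \<phi> (g i))
        = (\<Sum>i\<in>{i \<in> S. g i = a}. ennreal (p i)) * \<phi> a"
      by (simp add: sum_distrib_right)
    also have "(\<Sum>i\<in>{i \<in> S. g i = a}. ennreal (p i)) = ennreal (\<Sum>i\<in>{i \<in> S. g i = a}. p i)"
      using assms(2) by (intro sum_ennreal) auto
    finally show "(\<Sum>i\<in>{i \<in> S. g i = a}. ennreal (p i) * \<phi> (g i))
        = ennreal (\<Sum>i\<in>{i \<in> S. g i = a}. p i) * \<phi> a" .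
  qed
  finally show ?thesis .
qed

context finite_chain
begin

text \<open>
  A function of the block is mapped by one step of the chain to a function of the block, because the
  entries of a column summed over a block depend only on the block of the column. Killing at \<open>x\<close>
  respects this because no other state has the same block as \<open>x\<close>.
\<close>

lemma killed_step_lumped:
  assumes lump: "\<And>a j. a \<in> g ` S \<Longrightarrow> j \<in> S \<Longrightarrow> (\<Sum>i\<in>{i \<in> S. g i = a}. P i j) = Q a (g j)"
    and x: "\<And>i. i \<in> S \<Longrightarrow> g i = g x \<Longrightarrow> i = x"
    and \<psi>: "\<And>i. i \<in> S \<Longrightarrow> \<psi> i = \<phi> (g i)"
    and "j \<in> S"
  shows "(killed_step S P x ^^ n) \<psi> j = (killed_step (g ` S) Q (g x) ^^ n) \<phi> (g j)"
  using \<open>j \<in> S\<close>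
proof (induction n arbitrary: j)
  case 0
  then show ?case by (simp add: \<psi>)
next
  case (Suc n)
  let ?h = "(killed_step (g ` S) Q (g x) ^^ n) \<phi>"
  have "(\<Sum>i\<in>S. ennreal (P i j) * (killed_step S P x ^^ n) \<psi> i)
      = (\<Sum>i\<in>S. ennreal (P i j) * ?h (g i))"
    using Suc.IH by simp
  also have "\<dots> = (\<Sum>a\<in>g ` S. ennreal (\<Sum>i\<in>{i \<in> S. g i = a}. P i j) * ?h a)"
    using Suc.prems by (intro sum_nonneg_blocks_ennreal finite_states nonneg)
  also have "\<dots> = (\<Sum>a\<in>g ` S. ennreal (Q a (g j)) * ?h a)"
    using Suc.prems by (simp add: lump)
  finally show ?case
    \<comment> \<open>The definition is instantiated so that only the outermost step is unfolded, not the iterates.\<close>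
    using x[OF Suc.prems] by (auto simp: killed_step_def[where j=j] killed_step_def[where j="g j"])
qed

text \<open>
  Strong lumpability preserves expected hitting times of singleton blocks. The lumped matrix inherits
  nonnegativity and column sums from \<open>P\<close>, as each of its columns is a blockwise sum of a column of
  \<open>P\<close>; hence the tail sum formula applies to both chains.
\<close>

theorem expected_hitting_time_lumped:
  assumes lump: "\<And>a j. a \<in> g ` S \<Longrightarrow> j \<in> S \<Longrightarrow> (\<Sum>i\<in>{i \<in> S. g i = a}. P i j) = Q a (g j)"
    and x: "\<And>i. i \<in> S \<Longrightarrow> g i = g x \<Longrightarrow> i = x"
    and "y \<in> S"
  shows "expected_hitting_time S P x y = expected_hitting_time (g ` S) Q (g x) (g y)"
proof (cases "x = y")
  case True
  then show ?thesis by (simp add: expected_hitting_time_def)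
next
  case False
  have gy: "g y \<in> g ` S" and ne: "g x \<noteq> g y"
    using x[OF \<open>y \<in> S\<close>] \<open>y \<in> S\<close> False by auto
  interpret lumped: finite_chain "g ` S" Q
  proof
    show "finite (g ` S)" by (simp add: finite_states)
    show "0 \<le> Q a b" if a: "a \<in> g ` S" and b: "b \<in> g ` S" for a b
    proof -
      obtain j where j: "j \<in> S" "b = g j" using b by auto
      have "0 \<le> (\<Sum>i\<in>{i \<in> S. g i = a}. P i j)"
        using j by (intro sum_nonneg nonneg) auto
      then show ?thesis using a j by (simp add: lump)
    qed
    fix b assume "b \<in> g ` S"
    then obtain j where j: "j \<in> S" "b = g j" by auto
    have "(\<Sum>a\<in>g ` S. Q a b) = (\<Sum>a\<in>g ` S. \<Sum>i\<in>{i \<in> S. g i = a}. P i j)"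
      using j by (simp add: lump)
    also have "\<dots> = (\<Sum>i\<in>S. P i j)"
      by (rule sum.image_gen[OF finite_states, symmetric])
    finally show "(\<Sum>a\<in>g ` S. Q a b) = 1" by (simp add: stochastic j)
  qed
  have "(killed_step S P x ^^ n) (\<lambda>i. if i = x then 0 else 1) y
      = (killed_step (g ` S) Q (g x) ^^ n) (\<lambda>a. if a = g x then 0 else 1) (g y)" for n
    using x by (intro killed_step_lumped lump \<open>y \<in> S\<close>) auto
  then show ?thesis
    by (simp add: expected_hitting_time_eq_suminf[OF \<open>y \<in> S\<close> False]
        lumped.expected_hitting_time_eq_suminf[OF gy ne])
qed

end

section \<open>Quotients of the maximal entropy random walk\<close>

text \<open>The first arc of a path to a second vertex. It excludes the one-vertex graph without a loop,
  whose only column cannot be normalised to a probability vector.\<close>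

lemma connected_imp_neighbours_nonempty:
  assumes "pair_pseudo_graph G" and "Digraph_Component.connected (with_proj G)"
    and u: "u \<in> pverts G" and "v \<in> pverts G" and "u \<noteq> v"
  shows "neighbours G u \<noteq> {}"
proof -
  interpret pair_pseudo_graph G by fact
  have "u \<rightarrow>\<^sup>*\<^bsub>with_proj (mk_symmetric (with_proj G))\<^esub> v"
    using assms by (auto simp: Digraph_Component.connected_def strongly_connected_def)
  then have "u \<rightarrow>\<^sup>*\<^bsub>with_proj G\<^esub> v"
    using reachable_mk_symmetric_eq[OF pair_sym_arcs] by simp
  then obtain w where "(u, w) \<in> parcs G"
    using \<open>u \<noteq> v\<close> by (cases rule: converse_reachable_cases) auto
  then show ?thesis
    by (auto simp: neighbours_def dest: in_arcsD2)
qed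

context pair_pseudo_graph
begin

lemma finite_neighbours: "finite (neighbours G j)"
  by (simp add: neighbours_def pair_finite_verts)

lemma sum_adjacency:
  assumes "X \<subseteq> pverts G"
  shows "(\<Sum>i\<in>X. \<nu> i * adjacency_matrix G i j) = (\<Sum>i\<in>neighbours G j \<inter> X. \<nu> i)"
proof -
  have sym: "(i, j) \<in> parcs G \<longleftrightarrow> (j, i) \<in> parcs G" for i
    using pair_sym_arcs by (auto simp: symmetric_def dest: symD)
  have "(\<Sum>i\<in>X. \<nu> i * adjacency_matrix G i j) = (\<Sum>i\<in>X. if (j, i) \<in> parcs G then \<nu> i else 0)"
    by (intro sum.cong) (auto simp: adjacency_matrix_def sym)
  also have "\<dots> = (\<Sum>i\<in>{i \<in> X. (j, i) \<in> parcs G}. \<nu> i)"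
    using finite_subset[OF assms pair_finite_verts] by (simp add: sum.inter_filter)
  also have "{i \<in> X. (j, i) \<in> parcs G} = neighbours G j \<inter> X"
    using assms by (auto simp: neighbours_def)
  finally show ?thesis .
qed

lemma merw_matrix_block_sum:
  assumes "X \<subseteq> pverts G"
  shows "(\<Sum>i\<in>X. merw_matrix G \<nu> i j)
       = (\<Sum>i\<in>neighbours G j \<inter> X. \<nu> i) / (\<Sum>i\<in>neighbours G j. \<nu> i)"
proof -
  have "neighbours G j \<inter> pverts G = neighbours G j" by (auto simp: neighbours_def)
  then show ?thesis
    using sum_adjacency[OF assms] sum_adjacency[OF order_refl]
    by (simp add: merw_matrix_def transition_matrix_def flip: sum_divide_distrib)
qed

lemma finite_chain_merw:
  assumes pos: "\<And>i. i \<in> pverts G \<Longrightarrow> 0 < \<nu> i"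
    and nbr: "\<And>j. j \<in> pverts G \<Longrightarrow> neighbours G j \<noteq> {}"
  shows "finite_chain (pverts G) (merw_matrix G \<nu>)"
proof
  show "finite (pverts G)" by (rule pair_finite_verts)
  show "0 \<le> merw_matrix G \<nu> i j" if "i \<in> pverts G" for i j
    using that pos
    by (auto simp: merw_matrix_def transition_matrix_def adjacency_matrix_def less_imp_le
        intro!: divide_nonneg_nonneg sum_nonneg)
  fix j assume j: "j \<in> pverts G"
  have "0 < (\<Sum>i\<in>neighbours G j. \<nu> i)"
    using nbr[OF j] pos by (intro sum_pos finite_neighbours) (auto simp: neighbours_def)
  moreover have "neighbours G j \<inter> pverts G = neighbours G j" by (auto simp: neighbours_def)
  ultimately show "(\<Sum>i\<in>pverts G. merw_matrix G \<nu> i j) = 1"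
    by (simp add: merw_matrix_block_sum)
qed

lemma sum_weight_intersection_blocks:
  "(\<Sum>a\<in>g ` pverts G. weight_intersection G \<nu> {i \<in> pverts G. g i = a} j)
     = (1 / \<nu> j) * (\<Sum>i\<in>neighbours G j. \<nu> i)"
proof -
  have "(\<Sum>i\<in>neighbours G j. \<nu> i)
      = (\<Sum>a\<in>g ` pverts G. \<Sum>i\<in>{i \<in> neighbours G j. g i = a}. \<nu> i)"
    by (intro sum.group[symmetric] finite_neighbours finite_imageI pair_finite_verts)
       (auto simp: neighbours_def)
  also have "\<dots> = (\<Sum>a\<in>g ` pverts G. \<Sum>i\<in>neighbours G j \<inter> {i \<in> pverts G. g i = a}. \<nu> i)"
    by (intro sum.cong) (auto simp: neighbours_def)
  finally show ?thesis
    by (simp add: weight_intersection_def sum_distrib_left)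
qed

text \<open>
  The common factor \<open>1 / \<nu> j\<close> of the intersection numbers cancels when the column of the quotient
  matrix is normalised, leaving the probability that the walk moves from \<open>j\<close> into the block.
\<close>

lemma merw_matrix_lumps:
  assumes pos: "\<And>i. i \<in> pverts G \<Longrightarrow> 0 < \<nu> i"
    and b: "\<And>a j. a \<in> g ` pverts G \<Longrightarrow> j \<in> pverts G \<Longrightarrow>
        b a (g j) = weight_intersection G \<nu> {i \<in> pverts G. g i = a} j"
    and a: "a \<in> g ` pverts G" and j: "j \<in> pverts G"
  shows "(\<Sum>i\<in>{i \<in> pverts G. g i = a}. merw_matrix G \<nu> i j)
       = transition_matrix (g ` pverts G) b a (g j)"
proof -
  have "(\<Sum>i\<in>{i \<in> pverts G. g i = a}. merw_matrix G \<nu> i j)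
      = (\<Sum>i\<in>neighbours G j \<inter> {i \<in> pverts G. g i = a}. \<nu> i) / (\<Sum>i\<in>neighbours G j. \<nu> i)"
    by (rule merw_matrix_block_sum) auto
  also have "\<dots> = weight_intersection G \<nu> {i \<in> pverts G. g i = a} j
      / (\<Sum>a\<in>g ` pverts G. weight_intersection G \<nu> {i \<in> pverts G. g i = a} j)"
    using pos[OF j] by (simp add: sum_weight_intersection_blocks) (simp add: weight_intersection_def)
  also have "\<dots> = transition_matrix (g ` pverts G) b a (g j)"
    using a j by (simp add: transition_matrix_def b)
  finally show ?thesis .
qed

end

lemma weight_quotient_graph_weight:
  assumes "weight_equitable G \<nu> L B" and "i \<in> L" "B i \<noteq> {}" and "j \<in> L" "u \<in> B j"
  shows "weight (weight_quotient_graph G \<nu> L B) i j = weight_intersection G \<nu> (B i) u"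
proof -
  have "\<forall>w\<in>B j. weight_intersection G \<nu> (B i) w = weight_intersection G \<nu> (B i) u"
    using assms unfolding weight_equitable_def by blast
  then have "(THE b. \<forall>w\<in>B j. weight_intersection G \<nu> (B i) w = b) = weight_intersection G \<nu> (B i) u"
    by (rule the_equality) (metis \<open>u \<in> B j\<close>)
  then show ?thesis
    using assms(2-5) by (auto simp: weight_quotient_graph_def)
qed

text \<open>The base vertex of the quotient graph of a color may be taken to be the target \<open>v\<close>, whose
  blocks are the fibres of \<open>f v\<close>.\<close>

lemma color_quotient_graph_eq:
  assumes "weakly_weight_f_equitable G \<nu> f C R" and "v \<in> pverts G"
  shows "color_quotient_graph G \<nu> f R (f v v) = vertex_quotient_graph G \<nu> f R v"
  unfolding color_quotient_graph_def
proof (rule the_equality)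
  show "\<exists>z\<in>pverts G. f z z = f v v \<and> vertex_quotient_graph G \<nu> f R v = vertex_quotient_graph G \<nu> f R z"
    using assms(2) by blast
next
  fix Q assume "\<exists>z\<in>pverts G. f z z = f v v \<and> Q = vertex_quotient_graph G \<nu> f R z"
  then obtain z where z: "z \<in> pverts G" "f z z = f v v" "Q = vertex_quotient_graph G \<nu> f R z"
    by blast
  have "\<forall>z\<in>pverts G. \<forall>z'\<in>pverts G. f z z = f z' z' \<longrightarrow>
      vertex_quotient_graph G \<nu> f R z = vertex_quotient_graph G \<nu> f R z'"
    using assms(1) unfolding weakly_weight_f_equitable_def by (elim conjE)
  from this[rule_format, OF z(1) assms(2) z(2)] z(3)
  show "Q = vertex_quotient_graph G \<nu> f R v" by (rule trans[rotated])
qed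

lemma mem_f_labels:
  assumes "color_relation_function (pverts G) f C R" and "v \<in> pverts G" "i \<in> pverts G"
  shows "f v i \<in> f_labels f R v"
proof -
  have "\<forall>v\<in>pverts G. \<forall>i\<in>pverts G. if i = v then f v i \<in> C else f v i \<in> R"
    using assms(1) unfolding color_relation_function_def by (elim conjE)
  from bspec[OF bspec[OF this assms(2)] assms(3)] show ?thesis
    by (cases "i = v") (simp_all add: f_labels_def)
qed

lemma vertex_quotient_graph_wverts:
  assumes "color_relation_function (pverts G) f C R" and "v \<in> pverts G"
  shows "wverts (vertex_quotient_graph G \<nu> f R v) = f v ` pverts G"
proof -
  have "wverts (vertex_quotient_graph G \<nu> f R v)
      = {a \<in> f_labels f R v. {i \<in> pverts G. f v i = a} \<noteq> {}}"
    by (simp add: vertex_quotient_graph_def weight_quotient_graph_def f_block_def)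
  also have "\<dots> = f v ` pverts G"
    using mem_f_labels[OF assms] by blast
  finally show ?thesis .
qed

theorem theorem3p2:
  fixes G :: "'a pair_pre_digraph"
    and \<nu> :: "'a \<Rightarrow> real"
    and f :: "'a \<Rightarrow> 'a \<Rightarrow> 'l"
    and C R :: "'l set"
    and u v :: 'a
  assumes "pair_pseudo_graph G"
    and "Digraph_Component.connected (with_proj G)"
    and "is_perron_eigenvector G \<nu>"
    and "weakly_weight_f_equitable G \<nu> f C R"
    and "u \<in> pverts G" and "v \<in> pverts G"
  shows "merw_hitting_time G \<nu> v u =
         srw_hitting_time (color_quotient_graph G \<nu> f R (f v v)) (f v v) (f v u)"
proof (cases "u = v")
  case True
  then show ?thesis
    by (simp add: merw_hitting_time_def srw_hitting_time_def expected_hitting_time_def)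
next
  case False
  interpret pair_pseudo_graph G by fact
  let ?Q = "vertex_quotient_graph G \<nu> f R v"
  have pos: "\<And>i. i \<in> pverts G \<Longrightarrow> 0 < \<nu> i"
    using assms(3) by (simp add: is_perron_eigenvector_def)
  note axioms = assms(4)[unfolded weakly_weight_f_equitable_def]
  note crf = conjunct1[OF axioms]
    and root = bspec[OF conjunct1[OF conjunct2[OF axioms]] assms(6)]
    and equitable = bspec[OF conjunct1[OF conjunct2[OF conjunct2[OF axioms]]] assms(6)]
  \<comment> \<open>Two distinct vertices exist, so every vertex has a different one to be connected to.\<close>
  have "neighbours G j \<noteq> {}" if "j \<in> pverts G" for j
  proof -
    obtain k where "k \<in> pverts G" "j \<noteq> k"
      using False assms(5,6) by (cases "j = u") auto
    then show ?thesis
      by (rule connected_imp_neighbours_nonempty[OF assms(1,2) that])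
  qed
  then interpret merw: finite_chain "pverts G" "merw_matrix G \<nu>"
    by (intro finite_chain_merw pos)
  have weight: "weight ?Q a (f v j) = weight_intersection G \<nu> {i \<in> pverts G. f v i = a} j"
    if "a \<in> f v ` pverts G" "j \<in> pverts G" for a j
    using weight_quotient_graph_weight[OF equitable, of a "f v j" j] that
      mem_f_labels[OF crf assms(6)]
    by (auto simp: vertex_quotient_graph_def f_block_def)
  have "expected_hitting_time (pverts G) (merw_matrix G \<nu>) v u
      = expected_hitting_time (f v ` pverts G) (transition_matrix (f v ` pverts G) (weight ?Q))
          (f v v) (f v u)"
  proof (rule merw.expected_hitting_time_lumped)
    show "i = v" if "i \<in> pverts G" "f v i = f v v" for i
      using root that by (auto simp: f_block_def)
    show "(\<Sum>i\<in>{i \<in> pverts G. f v i = a}. merw_matrix G \<nu> i j)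
        = transition_matrix (f v ` pverts G) (weight ?Q) a (f v j)"
      if "a \<in> f v ` pverts G" "j \<in> pverts G" for a j
      by (rule merw_matrix_lumps[OF pos weight that])
  qed (rule assms(5))
  then show ?thesis
    by (simp add: merw_hitting_time_def srw_hitting_time_def color_quotient_graph_eq[OF assms(4,6)]
        vertex_quotient_graph_wverts[OF crf assms(6)])
qed

end
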